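(* Let $C\subset[0,1]$ be the usual middle-third Cantor set and let $\mathbf{BA}(1,1)\subset\mathbb{R}$ be the set of badly approximable numbers. For Schmidt's game played on $C$, $$\operatorname{Windim}(C\cap\mathbf{BA}(1,1))\le\tfrac13 .$$
   Context: **Badly approximable numbers.** $A\in\mathbb{R}$ is badly approximable if there is $c>0$ such that the distance from $Ax$ to the nearest integer is $>c|x|^{-1}$ for every nonzero integer $x$. **Schmidt's game on a compact set $\mathcal{K}\subset\mathbb{R}^n$.** Fix $0<\alpha,\beta<1$ and a target set $\mathcal{S}\subset\mathcal{K}$. All balls are closed Euclidean balls of $\mathbb{R}^n$ with centers in $\mathcal{K}$, and containments are between balls of $\mathbb{R}^n$. Player Black first chooses a ball $U(0)$ of some radius $\rho>0$ (with $\rho\le\operatorname{diam}\mathcal{K}$, a convention costing no generality). Given Black's ball $U(k)$, White chooses a ball $W(k)\subset U(k)$ with radius $\alpha$ times that of $U(k)$; then Black chooses a ball $U(k+1)\subset W(k)$ with radius $\beta$ times that of $W(k)$; and so on. White wins if the unique point of $\bigcap_k U(k)$ lies in $\mathcal{S}$; otherwise Black wins. $\mathcal{S}$ is $(\alpha,\beta)$-winning if White has a winning strategy, and $\alpha$-winning if it is $(\alpha,\beta)$-winning for all $\beta\in(0,1)$. Here $n=1$ and $\mathcal{K}=C$. **Winning dimension.** $\operatorname{Windim}(\mathcal{S})=0$ if $\mathcal{S}$ is $\alpha$-winning for no $\alpha>0$; otherwise $\operatorname{Windim}(\mathcal{S})$ is the least upper bound of all $0<\alpha<1$ such that $\mathcal{S}$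 is $\alpha$-winning. *)

theory Defs
  imports "HOL-Analysis.Analysis"
begin

definition badly_approximable :: "real \<Rightarrow> bool" where
  "badly_approximable A \<longleftrightarrow>
     (\<exists>c>0. \<forall>x::int. x \<noteq> 0 \<longrightarrow>
        \<bar>A * of_int x - of_int (round (A * of_int x))\<bar> > c * inverse \<bar>of_int x\<bar>)"

(* At stage n the middle thirds of all triadic intervals [k/3^n, (k+1)/3^n] are removed.
   For those intervals that were already removed at an earlier stage this has no effect. *)
definition cantor_set :: "real set" where
  "cantor_set = {0..1} -
     (\<Union>n::nat. \<Union>k\<in>{..<3 ^ n}. {real (3 * k + 1) / 3 ^ (n + 1) <..< real (3 * k + 2) / 3 ^ (n + 1)})"

(* In Schmidt's game a ball is represented by its center and radius.  In a Euclidean space of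
   positive dimension a closed ball of positive radius determines both. *)

definition next_ball :: "'a::euclidean_space set \<Rightarrow> real \<Rightarrow> 'a \<times> real \<Rightarrow> 'a \<times> real \<Rightarrow> bool" where
  "next_ball K \<gamma> B B' \<longleftrightarrow>
     fst B' \<in> K \<and> snd B' = \<gamma> * snd B \<and> cball (fst B') (snd B') \<subseteq> cball (fst B) (snd B)"

definition first_ball :: "'a::euclidean_space set \<Rightarrow> 'a \<times> real \<Rightarrow> bool" where
  "first_ball K B \<longleftrightarrow> fst B \<in> K \<and> 0 < snd B \<and> snd B \<le> diameter K"

(* A strategy of White maps the list of Black's balls so far to White's answer. *)
definition response ::
    "(('a \<times> real) list \<Rightarrow> 'a \<times> real) \<Rightarrow> (nat \<Rightarrow> 'a \<times> real) \<Rightarrow> nat \<Rightarrow> 'a \<times> real" where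
  "response \<sigma> U k = \<sigma> (map U [0..<Suc k])"

(* The first conjunct makes White's answer legal in every position in which Black has moved
   legally so far; without it White could win vacuously by an illegal move that leaves Black
   without any legal answer. *)
definition winning_strategy ::
    "'a::euclidean_space set \<Rightarrow> real \<Rightarrow> real \<Rightarrow> 'a set \<Rightarrow> (('a \<times> real) list \<Rightarrow> 'a \<times> real) \<Rightarrow> bool" where
  "winning_strategy K \<alpha> \<beta> S \<sigma> \<longleftrightarrow>
     (\<forall>U. first_ball K (U 0) \<longrightarrow>
        (\<forall>k. (\<forall>j<k. next_ball K \<beta> (response \<sigma> U j) (U (Suc j))) \<longrightarrow>
             next_ball K \<alpha> (U k) (response \<sigma> U k)) \<and>
        ((\<forall>k. next_ball K \<beta> (response \<sigma> U k) (U (Suc k))) \<longrightarrow>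
           (\<exists>x. (\<Inter>k. cball (fst (U k)) (snd (U k))) = {x} \<and> x \<in> S)))"

definition winning2 :: "'a::euclidean_space set \<Rightarrow> real \<Rightarrow> real \<Rightarrow> 'a set \<Rightarrow> bool" where
  "winning2 K \<alpha> \<beta> S \<longleftrightarrow> (\<exists>\<sigma>. winning_strategy K \<alpha> \<beta> S \<sigma>)"

definition winning :: "'a::euclidean_space set \<Rightarrow> real \<Rightarrow> 'a set \<Rightarrow> bool" where
  "winning K \<alpha> S \<longleftrightarrow> (\<forall>\<beta>. 0 < \<beta> \<and> \<beta> < 1 \<longrightarrow> winning2 K \<alpha> \<beta> S)"

definition Windim :: "'a::euclidean_space set \<Rightarrow> 'a set \<Rightarrow> real" where
  "Windim K S =
     (if \<exists>\<alpha>. 0 < \<alpha> \<and> \<alpha> < 1 \<and> winning K \<alpha> S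
      then Sup {\<alpha>. 0 < \<alpha> \<and> \<alpha> < 1 \<and> winning K \<alpha> S} else 0)"

end

(* Black wins for alpha > 1/3 by keeping every ball centered at 0 with radius a power of 1/3.
   If Black's ball is [-r, r], then White's center w lies in C and w <= (1 - alpha) r < 2r/3, so
   the gap (r/3, 2r/3) of C forces w <= r/3 < alpha r.  Hence 0 is an interior point of White's
   ball, and if alpha beta is a power of 1/3 that is at most alpha - 1/3, then Black can
   center the next ball at 0 again.  The outcome is 0, which is not badly approximable. *)
theory Submission
  imports Defs
begin

lemma not_badly_approximable_0: "\<not> badly_approximable 0"
  by (auto simp: badly_approximable_def intro: exI[of _ 1])

lemma zero_in_cantor_set: "0 \<in> cantor_set"
  by (auto simp: cantor_set_def divide_less_0_iff)

lemma one_in_cantor_set: "1 \<in> cantor_set"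
proof -
  have False if "k < 3 ^ n" "1 < real (3 * k + 2) / 3 ^ (n + 1)" for k n :: nat
  proof -
    have "real (3 ^ (n + 1)) < real (3 * k + 2)"
      using that(2) by (simp add: field_simps)
    then have "3 * 3 ^ n < 3 * k + 2"
      by (metis of_nat_less_iff power_Suc Suc_eq_plus1)
    \<comment> \<open>Over the naturals, \<open>k < 3 ^ n\<close> means \<open>k + 1\<close> \<le>
      \<open>3 ^ n\<close>, so \<open>3 * k + 3\<close> \<le> \<open>3 * 3 ^ n\<close>.\<close>
    with that(1) show False by linarith
  qed
  then show ?thesis
    by (auto simp: cantor_set_def)
qed

text \<open>Makes radius 1 legal for Black's opening ball.\<close>

lemma diameter_cantor_set_ge_1: "1 \<le> diameter cantor_set"
proof -
  have "bounded cantor_set"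
    by (rule bounded_subset[of "{0..1}"]) (auto simp: cantor_set_def)
  from diameter_bounded_bound[OF this zero_in_cantor_set one_in_cantor_set] show ?thesis
    by simp
qed

text \<open>The open interval between the two bounds is the leftmost one removed at stage
  \<open>n\<close>, the case \<open>k = 0\<close>.\<close>

lemma cantor_set_gap_at_0:
  assumes "w \<in> cantor_set" "w < 2 / 3 * (1 / 3) ^ n"
  shows "w \<le> 1 / 3 * (1 / 3) ^ n"
proof (rule ccontr)
  assume "\<not> ?thesis"
  with assms(2) have "w \<in> {real (3 * 0 + 1) / 3 ^ (n + 1) <..< real (3 * 0 + 2) / 3 ^ (n + 1)}"
    by (simp add: power_one_over field_simps)
  moreover have "(0::nat) \<in> {..<3 ^ n}"
    by simp
  ultimately show False
    using assms(1) unfolding cantor_set_def by blast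
qed

lemma next_ball_at_0:
  assumes \<alpha>: "1 / 3 < \<alpha>" and \<alpha>\<beta>: "0 \<le> \<alpha> * \<beta>" "\<alpha> * \<beta> \<le> \<alpha> - 1 / 3"
    and W: "next_ball cantor_set \<alpha> (0, (1 / 3) ^ n) W"
  shows "next_ball cantor_set \<beta> W (0, \<alpha> * \<beta> * (1 / 3) ^ n)"
proof -
  define r :: real where "r = (1 / 3) ^ n"
  have r: "0 < r"
    by (simp add: r_def)
  have w: "fst W \<in> cantor_set" and rad: "snd W = \<alpha> * r"
    and sub: "cball (fst W) (snd W) \<subseteq> cball 0 r"
    using W by (auto simp: next_ball_def r_def)
  have "0 < \<alpha> * r"
    using \<alpha> r by simp
  \<comment> \<open>For balls of positive radius, containment says that the distance of the centers
    plus the inner radius is at most the outer radius.\<close>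
  then have "\<bar>fst W\<bar> + \<alpha> * r \<le> r"
    using sub by (simp add: rad cball_subset_cball_iff)
  moreover have "1 / 3 * r < \<alpha> * r"
    using \<alpha> r by (rule mult_strict_right_mono)
  ultimately have "fst W < 2 / 3 * r"
    by linarith
  then have "fst W \<le> 1 / 3 * r"
    using cantor_set_gap_at_0[OF w] by (simp add: r_def)
  moreover have "0 \<le> fst W"
    using w by (simp add: cantor_set_def)
  moreover have "\<alpha> * \<beta> * r \<le> (\<alpha> - 1 / 3) * r"
    using \<alpha>\<beta>(2) r by (simp add: mult_right_mono)
  \<comment> \<open>White's center is within \<open>1 / 3 * r\<close> of 0, which leaves room for a
    ball around 0 of radius \<open>(\<alpha> - 1 / 3) * r\<close> inside White's.\<close>
  ultimately have "\<bar>fst W\<bar> + \<alpha> * \<beta> * r \<le> \<alpha> * r"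
    by (simp add: algebra_simps)
  then show ?thesis
    using zero_in_cantor_set rad
    by (simp add: next_ball_def cball_subset_cball_iff flip: r_def)
qed

text \<open>One full round scales the radius by \<alpha>\<beta>. Since this is a power of 1/3, every
  ball of Black matches a gap of the Cantor set.\<close>

lemma not_winning2_cantor_set:
  assumes \<alpha>: "1 / 3 < \<alpha>" and \<alpha>\<beta>: "\<alpha> * \<beta> = (1 / 3) ^ m" "\<alpha> * \<beta> \<le> \<alpha> - 1 / 3"
    and S: "0 \<notin> S"
  shows "\<not> winning2 cantor_set \<alpha> \<beta> S"
proof
  assume "winning2 cantor_set \<alpha> \<beta> S"
  then obtain \<sigma> where \<sigma>: "winning_strategy cantor_set \<alpha> \<beta> S \<sigma>"
    by (auto simp: winning2_def)
  \<comment> \<open>Black's play is fixed in advance, whatever White answers.\<close>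
  define U :: "nat \<Rightarrow> real \<times> real" where "U k = (0, (1 / 3) ^ (m * k))" for k
  have "first_ball cantor_set (U 0)"
    using zero_in_cantor_set diameter_cantor_set_ge_1 by (simp add: first_ball_def U_def)
  with \<sigma> have
    legal: "\<And>k. (\<And>j. j < k \<Longrightarrow> next_ball cantor_set \<beta> (response \<sigma> U j) (U (Suc j)))
      \<Longrightarrow> next_ball cantor_set \<alpha> (U k) (response \<sigma> U k)" and
    win: "(\<And>k. next_ball cantor_set \<beta> (response \<sigma> U k) (U (Suc k)))
      \<Longrightarrow> \<exists>x. (\<Inter>k. cball (fst (U k)) (snd (U k))) = {x} \<and> x \<in> S"
    unfolding winning_strategy_def by blast+
  have "next_ball cantor_set \<beta> (response \<sigma> U k) (U (Suc k))" for k
  \<comment> \<open>White's answer in round \<open>k\<close> is known to be legal only once all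
    earlier moves of Black are, hence strong induction.\<close>
  proof (induction k rule: less_induct)
    case (less k)
    have "next_ball cantor_set \<beta> (response \<sigma> U k) (0, \<alpha> * \<beta> * (1 / 3) ^ (m * k))"
      by (rule next_ball_at_0) (use \<alpha> \<alpha>\<beta> legal[OF less] in \<open>simp_all add: U_def\<close>)
    moreover have "U (Suc k) = (0, \<alpha> * \<beta> * (1 / 3) ^ (m * k))"
      by (simp add: U_def \<alpha>\<beta>(1) power_add)
    ultimately show ?case
      by simp
  qed
  from win[OF this] obtain x
    where x: "(\<Inter>k. cball (fst (U k)) (snd (U k))) = {x}" "x \<in> S"
    by blast
  have "0 \<in> (\<Inter>k. cball (fst (U k)) (snd (U k)))"
    by (simp add: U_def)
  with x S show False
    by auto
qed

lemma winning_cantor_set_le: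
  assumes "winning cantor_set \<alpha> S" "0 \<notin> S"
  shows "\<alpha> \<le> 1 / 3"
proof (rule ccontr)
  assume "\<not> ?thesis"
  then have \<alpha>: "1 / 3 < \<alpha>"
    by simp
  then obtain m where m: "(1 / 3) ^ m < \<alpha> - 1 / 3"
    using real_arch_pow_inv[of "\<alpha> - 1 / 3" "1 / 3"] by auto
  define \<beta> where "\<beta> = (1 / 3) ^ m / \<alpha>"
  have \<alpha>\<beta>: "\<alpha> * \<beta> = (1 / 3) ^ m"
    using \<alpha> by (simp add: \<beta>_def)
  \<comment> \<open>The upper bound holds because \<open>(1 / 3) ^ m\<close> is below \<alpha> - 1/3
    and hence below \<alpha>.\<close>
  have "0 < \<beta>" "\<beta> < 1"
    using \<alpha> m by (simp_all add: \<beta>_def)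
  then have "winning2 cantor_set \<alpha> \<beta> S"
    using assms(1) by (simp add: winning_def)
  then show False
    using not_winning2_cantor_set[OF \<alpha> \<alpha>\<beta> _ assms(2)] m \<alpha>\<beta> by simp
qed

theorem proposition4:
  "Windim cantor_set (cantor_set \<inter> {A. badly_approximable A}) \<le> 1 / 3"
proof -
  let ?S = "cantor_set \<inter> {A. badly_approximable A}"
  have "\<alpha> \<le> 1 / 3" if "winning cantor_set \<alpha> ?S" for \<alpha>
    using that by (rule winning_cantor_set_le) (simp add: not_badly_approximable_0)
  \<comment> \<open>\<open>cSup_least\<close> needs a nonempty set; in the empty case
    \<open>Windim\<close> is 0 by definition.\<close>
  then have "Sup {\<alpha>. 0 < \<alpha> \<and> \<alpha> < 1 \<and> winning cantor_set \<alpha> ?S} \<le> 1 / 3"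
    if "\<exists>\<alpha>. 0 < \<alpha> \<and> \<alpha> < 1 \<and> winning cantor_set \<alpha> ?S"
    by (intro cSup_least) (use that in blast)+
  then show ?thesis
    by (simp only: Windim_def split: if_split) simp
qed

end
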